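(* Let $n\ge 4$ and let $\mathcal{G}=\{G_1,G_2,\ldots,G_n\}$ be a family of graphs on the same vertex set $[n]$ such that $\rho(G_i)>n-2$ for every $i=1,\ldots,n$. Then $\mathcal{G}$ admits a rainbow Hamiltonian cycle, unless $G_1=G_2=\cdots=G_n\cong K_1\vee(K_{n-2}\cup K_1)$.
   Context: $\rho(G)$ is the spectral radius (largest eigenvalue) of the adjacency matrix of $G$. $\vee$ denotes the join and $\cup$ the disjoint union of graphs; $K_1\vee(K_{n-2}\cup K_1)$ is the graph consisting of $K_{n-1}$ plus one extra vertex of degree 1 adjacent to a vertex of the $K_{n-1}$. $G_i=G_j$ means equal vertex and edge sets (not merely isomorphic). A rainbow Hamiltonian cycle in $\mathcal{G}$ is a Hamiltonian cycle on the common vertex set whose $n$ edges can be labeled $e_1,\ldots,e_n$ with $e_i\in E(G_i)$ for each $i$. *)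

theory Defs
  imports "Jordan_Normal_Form.Spectral_Radius"
begin

definition graph_on :: "nat \<Rightarrow> nat set set \<Rightarrow> bool" where
  "graph_on n E \<longleftrightarrow> (\<forall>e\<in>E. e \<subseteq> {1..n} \<and> card e = 2)"

text \<open>Adjacency matrix (as a complex n x n matrix); row/column index i stands for vertex i+1.\<close>

definition adj_mat :: "nat \<Rightarrow> nat set set \<Rightarrow> complex mat" where
  "adj_mat n E = mat n n (\<lambda>(i, j). if {i + 1, j + 1} \<in> E then 1 else 0)"

definition graph_rho :: "nat \<Rightarrow> nat set set \<Rightarrow> real" where
  "graph_rho n E = spectral_radius (adj_mat n E)"

text \<open>Rainbow Hamiltonian cycle for the family G 1, ..., G n on [n]:
  a cyclic ordering v 0, ..., v (n-1) of all vertices (cycle edges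
  {v k, v ((k+1) mod n)}) and a bijective labelling s of the graphs by the
  cycle edges such that the edge assigned to G i lies in G i.\<close>

definition rainbow_ham_cycle :: "nat \<Rightarrow> (nat \<Rightarrow> nat set set) \<Rightarrow> bool" where
  "rainbow_ham_cycle n G \<longleftrightarrow>
     (\<exists>v s. bij_betw v {0..<n} {1..n} \<and> bij_betw s {1..n} {0..<n} \<and>
        (\<forall>i\<in>{1..n}. {v (s i), v ((s i + 1) mod n)} \<in> G i))"

text \<open>The graph K_1 \<or> (K_{n-2} \<union> K_1) on [n], in a standard labelling:
  a clique on {1..n-1} (= K_1 \<or> K_{n-2}, the join vertex being 1) plus the
  pendant vertex n joined to vertex 1 only.\<close>

definition K1_join_Kn2_K1 :: "nat \<Rightarrow> nat set set" where
  "K1_join_Kn2_K1 n = {{a, b} | a b. a \<in> {1..n-1} \<and> b \<in> {1..n-1} \<and> a \<noteq> b} \<union> {{1, n}}"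

definition graph_iso :: "nat \<Rightarrow> nat set set \<Rightarrow> nat set set \<Rightarrow> bool" where
  "graph_iso n E F \<longleftrightarrow> (\<exists>f. bij_betw f {1..n} {1..n} \<and> F = (\<lambda>e. f ` e) ` E)"

end

theory Submission
  imports Defs "HOL-Combinatorics.Transposition"
begin

text \<open>
  Let \<open>m\<close> be the number of edges and \<open>d\<close> the degree function of a graph of minimum degree at least
  \<open>\<delta>\<close>. The weights \<open>d x + n - 1 - \<delta>\<close> in the Collatz--Wielandt bound show that
  \<open>2 m \<le> (n - 1)(n - 2) + \<delta>\<close> forces spectral radius at most \<open>n - 2\<close>. With \<open>\<delta> = 0\<close> and \<open>\<delta> = 2\<close>, each
  graph of the family either lacks at most \<open>n - 3\<close> edges, or is a clique on \<open>n - 1\<close> vertices plus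
  one pendant edge.

  If some graph lacks at most \<open>n - 3\<close> edges, compress the whole family (replace vertex \<open>j\<close> by
  \<open>i < j\<close> in edges where possible). Compression keeps the edge counts and creates no new rainbow
  Hamiltonian cycle, and in a fully compressed family the cycle \<open>1, n, 2, n - 1, 3, \<dots>\<close> works: only
  its edge \<open>{2, n}\<close> can be missing from a graph, and it is given to the graph lacking at most
  \<open>n - 3\<close> edges. If all graphs are cliques with a pendant edge, a rainbow cycle is written down
  explicitly unless they all coincide.
\<close>

section \<open>Two-element subsets\<close>

definition pairs :: "nat set \<Rightarrow> nat set set" where
  "pairs V = {e. e \<subseteq> V \<and> card e = 2}"

lemma graph_on_pairs: "graph_on n E \<longleftrightarrow> E \<subseteq> pairs {1..n}"
  by (auto simp: graph_on_def pairs_def)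

lemma finite_pairs: "finite V \<Longrightarrow> finite (pairs V)"
  by (simp add: pairs_def)

lemma card_pairs: "finite V \<Longrightarrow> card (pairs V) = card V choose 2"
  by (simp add: pairs_def n_subsets)

lemma doubleton_pairs: "{x, y} \<in> pairs V \<longleftrightarrow> x \<in> V \<and> y \<in> V \<and> x \<noteq> y"
  by (auto simp: pairs_def card_2_iff doubleton_eq_iff)

lemma pairsE:
  assumes "e \<in> pairs V"
  obtains x y where "e = {x, y}" "x \<in> V" "y \<in> V" "x \<noteq> y"
  using assms by (auto simp: pairs_def card_2_iff)

lemma choose_two_double: "2 * (m choose 2) = m * (m - 1)" for m :: nat
proof -
  have "even (m * (m - 1))" by (cases m) auto
  then show ?thesis by (simp add: choose_two)
qed

section \<open>Spectral radius and degrees\<close>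

definition adj :: "nat set set \<Rightarrow> nat \<Rightarrow> nat \<Rightarrow> real" where
  "adj E x y = (if {x, y} \<in> E then 1 else 0)"

definition deg :: "nat set set \<Rightarrow> nat \<Rightarrow> nat" where
  "deg E x = card {e \<in> E. x \<in> e}"

lemma adj_commute: "adj E x y = adj E y x"
  by (simp add: adj_def insert_commute)

lemma sum_adj_eq_deg:
  assumes "graph_on n E"
  shows "(\<Sum>y\<in>{1..n}. adj E x y) = real (deg E x)"
proof -
  have "(\<Sum>y\<in>{1..n}. adj E x y) = real (card {y\<in>{1..n}. {x, y} \<in> E})"
    by (simp add: adj_def sum.If_cases Int_def)
  also have "card {y\<in>{1..n}. {x, y} \<in> E} = deg E x"
    unfolding deg_def
  proof (rule bij_betw_same_card[of "\<lambda>y. {x, y}"], unfold bij_betw_def, intro conjI)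
    show "inj_on (\<lambda>y. {x, y}) {y \<in> {1..n}. {x, y} \<in> E}"
      by (auto simp: inj_on_def doubleton_eq_iff)
    show "(\<lambda>y. {x, y}) ` {y \<in> {1..n}. {x, y} \<in> E} = {e \<in> E. x \<in> e}" (is "?L = ?R")
    proof
      show "?L \<subseteq> ?R" by auto
      show "?R \<subseteq> ?L"
      proof
        fix e assume e: "e \<in> ?R"
        then have "e \<in> pairs {1..n}" using assms graph_on_pairs by auto
        then obtain p q where "e = {p, q}" "p \<in> {1..n}" "q \<in> {1..n}" by (elim pairsE)
        with e show "e \<in> ?L" by (auto simp: image_iff insert_commute)
      qed
    qed
  qed
  finally show ?thesis .
qed

lemma handshake:
  assumes "graph_on n E"
  shows "(\<Sum>x\<in>{1..n}. deg E x) = 2 * card E"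
proof -
  have sub: "E \<subseteq> pairs {1..n}" using assms graph_on_pairs by simp
  then have fin: "finite E" using finite_pairs finite_subset by blast
  have "(\<Sum>x\<in>{1..n}. deg E x) = (\<Sum>x\<in>{1..n}. \<Sum>e\<in>E. if x \<in> e then 1 else 0)"
    using fin by (simp add: deg_def sum.If_cases Int_def)
  also have "\<dots> = (\<Sum>e\<in>E. \<Sum>x\<in>{1..n}. if x \<in> e then 1 else 0)"
    by (rule sum.swap)
  also have "\<dots> = (\<Sum>e\<in>E. 2)"
  proof (rule sum.cong)
    fix e assume "e \<in> E"
    then have "e \<subseteq> {1..n}" "card e = 2" using sub by (auto simp: pairs_def)
    then show "(\<Sum>x\<in>{1..n}. if x \<in> e then 1 else 0) = (2::nat)"
      by (simp add: sum.If_cases Int_absorb1)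
  qed simp
  finally show ?thesis by simp
qed

text \<open>Take an eigenvalue of maximal modulus and the moduli of the entries of one of its
  eigenvectors: the triangle inequality turns the eigenvector equation into this inequality. This
  stands in for a Perron eigenvector.\<close>

lemma graph_rho_subeigenvector:
  assumes "n > 0"
  obtains y :: "nat \<Rightarrow> real" where "\<And>x. y x \<ge> 0" "\<exists>x\<in>{1..n}. y x > 0"
    "\<And>x. x \<in> {1..n} \<Longrightarrow> graph_rho n E * y x \<le> (\<Sum>z\<in>{1..n}. adj E x z * y z)"
proof -
  let ?A = "adj_mat n E"
  have A: "?A \<in> carrier_mat n n" by (simp add: adj_mat_def)
  obtain k where "k \<in> spectrum ?A" and k: "graph_rho n E = norm k"
    using spectral_radius_mem_max(1)[OF A assms] by (auto simp: graph_rho_def)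
  then obtain v where v: "v \<in> carrier_vec n" "v \<noteq> 0\<^sub>v n" "?A *\<^sub>v v = k \<cdot>\<^sub>v v"
    using A by (auto simp: spectrum_def eigenvalue_def eigenvector_def)
  define y where "y x = norm (v $ (x - 1))" for x
  show thesis
  proof
    show "y x \<ge> 0" for x by (simp add: y_def)
    show "\<exists>x\<in>{1..n}. y x > 0"
    proof -
      have "\<exists>i<n. v $ i \<noteq> 0" using v(1,2) by auto
      then obtain i where "i < n" "v $ i \<noteq> 0" by blast
      then show ?thesis by (intro bexI[of _ "Suc i"]) (auto simp: y_def)
    qed
    fix x assume x: "x \<in> {1..n}"
    have "k * v $ (x - 1) = (?A *\<^sub>v v) $ (x - 1)" using v x by auto
    also have "\<dots> = (\<Sum>j = 0..<n. ?A $$ (x - 1, j) * v $ j)"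
      using A v(1) x by (auto simp: scalar_prod_def intro!: sum.cong)
    also have "\<dots> = (\<Sum>j = 0..<n. of_real (adj E x (Suc j)) * v $ j)"
      using x by (intro sum.cong) (auto simp: adj_mat_def adj_def)
    finally have "norm k * y x = norm (\<Sum>j = 0..<n. of_real (adj E x (Suc j)) * v $ j)"
      by (simp add: y_def flip: norm_mult)
    also have "\<dots> \<le> (\<Sum>j = 0..<n. adj E x (Suc j) * y (Suc j))"
      by (rule order_trans[OF norm_sum]) (auto simp: y_def norm_mult adj_def intro!: sum_mono)
    also have "\<dots> = (\<Sum>z\<in>{1..n}. adj E x z * y z)"
      using sum.shift_bounds_Suc_ivl[of "\<lambda>z. adj E x z * y z" 0 n]
      by (simp add: atLeastLessThanSuc_atLeastAtMost)
    finally show "graph_rho n E * y x \<le> (\<Sum>z\<in>{1..n}. adj E x z * y z)" by (simp add: k)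
  qed
qed

text \<open>Pair the vector \<open>y\<close> of \<open>graph_rho_subeigenvector\<close> with
  \<open>w\<close>. Since \<open>adj\<close> is symmetric, the adjacency operator can be moved from
  \<open>y\<close> to \<open>w\<close>, so \<open>graph_rho n E\<close> times the pairing is at most
  \<open>r\<close> times the pairing, which is positive.\<close>

lemma graph_rho_le_Collatz_Wielandt:
  assumes "n > 0" and pos: "\<And>x. x \<in> {1..n} \<Longrightarrow> w x > 0"
    and le: "\<And>x. x \<in> {1..n} \<Longrightarrow> (\<Sum>z\<in>{1..n}. adj E x z * w z) \<le> r * w x"
  shows "graph_rho n E \<le> r"
proof -
  obtain y :: "nat \<Rightarrow> real" where y: "\<And>x. y x \<ge> 0" "\<exists>x\<in>{1..n}. y x > 0"
    "\<And>x. x \<in> {1..n} \<Longrightarrow> graph_rho n E * y x \<le> (\<Sum>z\<in>{1..n}. adj E x z * y z)"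
    by (rule graph_rho_subeigenvector[OF assms(1), of E]) blast
  let ?s = "\<Sum>x\<in>{1..n}. w x * y x"
  obtain x0 where x0: "x0 \<in> {1..n}" "y x0 > 0" using y(2) by blast
  have "?s > 0"
  proof (rule sum_pos2[OF _ x0(1)])
    show "w x0 * y x0 > 0" using pos x0 by simp
    show "w x * y x \<ge> 0" if "x \<in> {1..n}" for x using pos[OF that] y(1)[of x] by simp
  qed simp
  have "graph_rho n E * ?s = (\<Sum>x\<in>{1..n}. w x * (graph_rho n E * y x))"
    by (simp add: sum_distrib_left mult_ac)
  also have "\<dots> \<le> (\<Sum>x\<in>{1..n}. w x * (\<Sum>z\<in>{1..n}. adj E x z * y z))"
    using y(3) pos by (intro sum_mono mult_left_mono) (auto intro: less_imp_le)
  also have "\<dots> = (\<Sum>x\<in>{1..n}. \<Sum>z\<in>{1..n}. w x * adj E x z * y z)"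
    by (simp add: sum_distrib_left mult_ac)
  also have "\<dots> = (\<Sum>z\<in>{1..n}. \<Sum>x\<in>{1..n}. w x * adj E x z * y z)"
    by (rule sum.swap)
  also have "\<dots> = (\<Sum>z\<in>{1..n}. y z * (\<Sum>x\<in>{1..n}. adj E z x * w x))"
    by (simp add: sum_distrib_left mult_ac adj_commute[of E])
  also have "\<dots> \<le> (\<Sum>z\<in>{1..n}. y z * (r * w z))"
    using le y(1) by (intro sum_mono mult_left_mono) auto
  also have "\<dots> = r * ?s" by (simp add: sum_distrib_left mult_ac)
  finally show ?thesis using \<open>?s > 0\<close> by simp
qed

lemma graph_rho_le_of_min_degree:
  assumes "graph_on n E" "n \<ge> 2" "\<delta> \<le> n - 2"
    and min: "\<And>x. x \<in> {1..n} \<Longrightarrow> deg E x \<ge> \<delta>"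
    and size: "2 * card E \<le> (n - 1) * (n - 2) + \<delta>"
  shows "graph_rho n E \<le> real n - 2"
proof (rule graph_rho_le_Collatz_Wielandt)
  define d where "d x = real (deg E x)" for x
  \<comment> \<open>With this constant the final estimate is an identity: the coefficient of
    \<open>d x\<close> in the bound is \<open>\<delta> - 1 + c = n - 2\<close>, and the terms free
    of \<open>d x\<close> add up to \<open>(n - 2) * c\<close>. As
    \<open>\<delta> \<le> n - 2\<close>, the weights are positive even at isolated vertices.\<close>
  define c where "c = real n - 1 - real \<delta>"
  have c: "c \<ge> 1" using assms(2,3) unfolding c_def by linarith
  show "n > 0" using assms by simp
  show "d x + c > 0" for x using c by (simp add: d_def add_nonneg_pos)
  fix x assume x: "x \<in> {1..n}"
  have "{x} \<notin> E" using assms(1) by (auto simp: graph_on_def)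
  then have xx: "adj E x x = 0" by (simp add: adj_def)
  have sd: "(\<Sum>z\<in>{1..n}. adj E x z) = d x" using sum_adj_eq_deg[OF assms(1)] by (simp add: d_def)
  have "(\<Sum>z\<in>{1..n}. d z) = real (\<Sum>z\<in>{1..n}. deg E z)" by (simp add: d_def)
  also have "\<dots> \<le> real ((n - 1) * (n - 2) + \<delta>)"
    unfolding handshake[OF assms(1)] using size by (rule of_nat_mono)
  also have "\<dots> = (real n - 1) * (real n - 2) + \<delta>" using assms(2) by (simp add: of_nat_diff)
  finally have tot: "(\<Sum>z\<in>{1..n}. d z) \<le> (real n - 1) * (real n - 2) + \<delta>" .
  \<comment> \<open>The degree sum over the neighbours of \<open>x\<close> is bounded through its
    complement: \<open>x\<close> itself contributes \<open>d x\<close>, and each of the other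
    \<open>n - 1 - d x\<close> non-neighbours contributes at least \<open>\<delta>\<close>.\<close>
  have "(\<Sum>z\<in>{1..n}. (1 - adj E x z) * d z) = d x + (\<Sum>z\<in>{1..n} - {x}. (1 - adj E x z) * d z)"
    using x xx by (simp add: sum.remove[of _ x])
  also have "\<dots> \<ge> d x + (\<Sum>z\<in>{1..n} - {x}. (1 - adj E x z) * \<delta>)"
    using min by (intro add_left_mono sum_mono mult_left_mono) (auto simp: adj_def d_def)
  also have "(\<Sum>z\<in>{1..n} - {x}. (1 - adj E x z) * \<delta>) = (\<Sum>z\<in>{1..n}. (1 - adj E x z) * \<delta>) - \<delta>"
    using x xx by (simp add: sum.remove[of _ x])
  also have "(\<Sum>z\<in>{1..n}. (1 - adj E x z) * \<delta>) = (n - d x) * \<delta>"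
    unfolding sum_distrib_right[symmetric] sum_subtractf sd by simp
  finally have "d x + ((n - d x) * \<delta> - \<delta>) \<le> (\<Sum>z\<in>{1..n}. (1 - adj E x z) * d z)" .
  also have "\<dots> = (\<Sum>z\<in>{1..n}. d z) - (\<Sum>z\<in>{1..n}. adj E x z * d z)"
    by (simp add: left_diff_distrib sum_subtractf)
  finally have nb: "(\<Sum>z\<in>{1..n}. adj E x z * d z)
      \<le> (real n - 1) * (real n - 2) + \<delta> - d x - ((n - d x) * \<delta> - \<delta>)"
    using tot by linarith
  have "(\<Sum>z\<in>{1..n}. adj E x z * (d z + c)) = (\<Sum>z\<in>{1..n}. adj E x z * d z) + d x * c"
    unfolding distrib_left sum.distrib sum_distrib_right[symmetric] sd ..
  also have "\<dots> \<le> (real n - 1) * (real n - 2) + \<delta> - d x - ((n - d x) * \<delta> - \<delta>) + d x * c"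
    using nb by linarith
  also have "\<dots> = (real n - 2) * (d x + c)"
    unfolding c_def by (simp add: algebra_simps)
  finally show "(\<Sum>z\<in>{1..n}. adj E x z * (d z + c)) \<le> (real n - 2) * (d x + c)" .
qed

text \<open>At most \<open>n - 3\<close> (below: at most \<open>n - 2\<close>) missing edges, stated without truncated subtraction.\<close>

definition dense :: "nat \<Rightarrow> nat set set \<Rightarrow> bool" where
  "dense n E \<longleftrightarrow> card E + n \<ge> (n choose 2) + 3"

text \<open>These are the only consequences of the spectral bound that the combinatorial argument
  uses, in a form that compression preserves (\<open>admissible_shift\<close>).\<close>

definition admissible :: "nat \<Rightarrow> nat set set \<Rightarrow> bool" where
  "admissible n E \<longleftrightarrow> graph_on n E \<and> card E + n \<ge> (n choose 2) + 2 \<and>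
     (dense n E \<or> (\<exists>u\<in>{1..n}. pairs ({1..n} - {u}) \<subseteq> E))"

lemma choose_two_pred: "n \<ge> 1 \<Longrightarrow> n choose 2 = ((n - 1) choose 2) + (n - 1)" for n :: nat
  by (cases n) (simp_all add: numeral_2_eq_2)

text \<open>Minimum degree bound 0 gives more than \<open>(n - 1) choose 2\<close> edges. A graph
  that is not dense then has exactly one edge more than that, and the bound for
  \<open>\<delta> = 2\<close>, available since \<open>n \<ge> 4\<close>, yields a vertex of degree
  at most 1. Deleting it leaves enough edges to fill the other \<open>n - 1\<close> vertices
  completely.\<close>

lemma admissible_of_graph_rho:
  assumes "n \<ge> 4" "graph_on n E" "graph_rho n E > real n - 2"
  shows "admissible n E"
proof -
  have sub: "E \<subseteq> pairs {1..n}" using assms graph_on_pairs by simp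
  then have fin: "finite E" using finite_pairs finite_subset by blast
  have "2 * card E > (n - 1) * (n - 2)"
    using graph_rho_le_of_min_degree[of n E 0] assms by force
  then have "2 * card E > 2 * ((n - 1) choose 2)"
    unfolding choose_two_double by (simp add: numeral_2_eq_2)
  then have m: "card E > (n - 1) choose 2" by simp
  then have m': "card E + n \<ge> (n choose 2) + 2"
    using choose_two_pred[of n] assms(1) by linarith
  moreover have "\<exists>u\<in>{1..n}. pairs ({1..n} - {u}) \<subseteq> E" if nd: "\<not> dense n E"
  proof -
    have "card E \<le> ((n - 1) choose 2) + 1"
      using nd choose_two_pred[of n] assms(1) by (simp add: dense_def)
    then have "2 * card E \<le> 2 * ((n - 1) choose 2) + 2" by simp
    then have "2 * card E \<le> (n - 1) * (n - 2) + 2"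
      unfolding choose_two_double by (simp add: numeral_2_eq_2)
    then obtain u where u: "u \<in> {1..n}" "deg E u < 2"
      using graph_rho_le_of_min_degree[of n E 2] assms by fastforce
    have eq: "E = {e\<in>E. u \<in> e} \<union> {e\<in>E. u \<notin> e}" by auto
    have "card E \<le> card {e\<in>E. u \<in> e} + card {e\<in>E. u \<notin> e}"
      using card_Un_le eq by metis
    then have "card {e\<in>E. u \<notin> e} \<ge> (n - 1) choose 2"
      using m u by (simp add: deg_def)
    moreover have "{e\<in>E. u \<notin> e} \<subseteq> pairs ({1..n} - {u})" using sub by (auto simp: pairs_def)
    moreover have "card (pairs ({1..n} - {u})) = (n - 1) choose 2"
      using u(1) by (simp add: card_pairs)
    ultimately have "{e\<in>E. u \<notin> e} = pairs ({1..n} - {u})"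
      by (intro card_seteq) (auto simp: finite_pairs)
    then show ?thesis using u(1) by blast
  qed
  ultimately show ?thesis using assms(2) by (auto simp: admissible_def)
qed

section \<open>Rainbow cycles\<close>

text \<open>The labelling is inverted: \<open>t k\<close> is the graph that supplies the edge at
  position \<open>k\<close>, so colours can be prescribed position by position.\<close>

lemma rainbow_ham_cycleI:
  assumes "bij_betw v {0..<n} {1..n}" "bij_betw t {0..<n} {1..n}"
    and "\<And>k. k < n \<Longrightarrow> {v k, v ((k + 1) mod n)} \<in> G (t k)"
  shows "rainbow_ham_cycle n G"
proof -
  let ?s = "inv_into {0..<n} t"
  have s: "bij_betw ?s {1..n} {0..<n}" using assms(2) by (rule bij_betw_inv_into)
  have "{v (?s i), v ((?s i + 1) mod n)} \<in> G i" if "i \<in> {1..n}" for i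
  proof -
    have "?s i < n" using s that by (auto dest: bij_betwE)
    moreover have "t (?s i) = i" using assms(2) that by (simp add: bij_betw_inv_into_right)
    ultimately show ?thesis using assms(3)[of "?s i"] by simp
  qed
  with s assms(1) show ?thesis unfolding rainbow_ham_cycle_def by blast
qed

lemma rainbow_ham_cycleE:
  assumes "rainbow_ham_cycle n G"
  obtains v t where "bij_betw v {0..<n} {1..n}" "bij_betw t {0..<n} {1..n}"
    "\<And>k. k < n \<Longrightarrow> {v k, v ((k + 1) mod n)} \<in> G (t k)"
proof -
  obtain v s where vs: "bij_betw v {0..<n} {1..n}" "bij_betw s {1..n} {0..<n}"
    "\<forall>i\<in>{1..n}. {v (s i), v ((s i + 1) mod n)} \<in> G i"
    using assms unfolding rainbow_ham_cycle_def by blast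
  let ?t = "inv_into {1..n} s"
  have t: "bij_betw ?t {0..<n} {1..n}" using vs(2) by (rule bij_betw_inv_into)
  have "{v k, v ((k + 1) mod n)} \<in> G (?t k)" if "k < n" for k
  proof -
    have "?t k \<in> {1..n}" using t that by (auto dest: bij_betwE)
    moreover have "s (?t k) = k" using vs(2) that by (simp add: bij_betw_inv_into_right)
    ultimately show ?thesis using vs(3) by metis
  qed
  with vs(1) t that show thesis by blast
qed

lemma bij_betw_mod_rotate:
  fixes r n :: nat
  assumes "r < n"
  shows "bij_betw (\<lambda>k. (k + r) mod n) {0..<n} {0..<n}"
proof -
  have "inj_on (\<lambda>k. (k + r) mod n) {0..<n}"
  proof (rule inj_onI)
    fix x y assume "x \<in> {0..<n}" "y \<in> {0..<n}" "(x + r) mod n = (y + r) mod n"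
    moreover have "(z + r) mod n = (if z + r < n then z + r else z + r - n)" if "z < n" for z :: nat
      using assms that by (simp add: le_mod_geq)
    ultimately show "x = y" using assms by (auto split: if_splits)
  qed
  moreover have "(\<lambda>k. (k + r) mod n) ` {0..<n} \<subseteq> {0..<n}" using assms by auto
  ultimately show ?thesis unfolding bij_betw_def
    by (simp add: card_image card_subset_eq)
qed

text \<open>Rotate vertices and colours by the same amount. In the compression argument this puts
  the two edges at \<open>i\<close> at positions \<open>0\<close> and \<open>n - 1\<close>.\<close>

lemma rainbow_ham_cycle_startE:
  assumes "rainbow_ham_cycle n G" "i \<in> {1..n}"
  obtains v t where "bij_betw v {0..<n} {1..n}" "bij_betw t {0..<n} {1..n}" "v 0 = i"
    "\<And>k. k < n \<Longrightarrow> {v k, v ((k + 1) mod n)} \<in> G (t k)"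
proof -
  obtain v t where vt: "bij_betw v {0..<n} {1..n}" "bij_betw t {0..<n} {1..n}"
    "\<And>k. k < n \<Longrightarrow> {v k, v ((k + 1) mod n)} \<in> G (t k)"
    using rainbow_ham_cycleE[OF assms(1)] by blast
  obtain r where r: "r < n" "v r = i"
    using vt(1) assms(2) by (metis atLeastLessThan_iff bij_betw_iff_bijections)
  let ?f = "\<lambda>k. (k + r) mod n"
  have f: "bij_betw ?f {0..<n} {0..<n}" using bij_betw_mod_rotate[OF r(1)] .
  show thesis
  proof
    show "bij_betw (v \<circ> ?f) {0..<n} {1..n}" using f vt(1) by (rule bij_betw_trans)
    show "bij_betw (t \<circ> ?f) {0..<n} {1..n}" using f vt(2) by (rule bij_betw_trans)
    show "(v \<circ> ?f) 0 = i" using r by simp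
    fix k assume "k < n"
    have "((k + 1) mod n + r) mod n = ((k + r) mod n + 1) mod n"
      by (simp add: mod_simps ac_simps)
    then show "{(v \<circ> ?f) k, (v \<circ> ?f) ((k + 1) mod n)} \<in> G ((t \<circ> ?f) k)"
      using vt(3)[of "?f k"] r(1) by simp
  qed
qed

lemma ex_bij_betw_extending:
  assumes "finite X" "finite Y" "card X = card Y" "A \<subseteq> X" "inj_on f A" "f ` A \<subseteq> Y"
  obtains g where "bij_betw g X Y" "\<And>x. x \<in> A \<Longrightarrow> g x = f x"
proof -
  have "card (X - A) = card (Y - f ` A)"
    using assms by (simp add: card_Diff_subset card_image finite_subset)
  then obtain h where h: "bij_betw h (X - A) (Y - f ` A)"
    using assms(1,2) finite_same_card_bij[of "X - A" "Y - f ` A"] by auto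
  let ?g = "\<lambda>x. if x \<in> A then f x else h x"
  have "bij_betw ?g A (f ` A)"
    using assms(5) by (auto simp: bij_betw_def inj_on_def)
  moreover have "bij_betw ?g (X - A) (Y - f ` A)"
    using h bij_betw_cong[of "X - A" h ?g "Y - f ` A"] by simp
  ultimately have "bij_betw ?g (A \<union> (X - A)) (f ` A \<union> (Y - f ` A))"
    by (rule bij_betw_combine) auto
  moreover have "A \<union> (X - A) = X" "f ` A \<union> (Y - f ` A) = Y" using assms by auto
  ultimately have "bij_betw ?g X Y" by simp
  then show thesis using that by simp
qed

section \<open>Compression\<close>

text \<open>Under the guard, the image under the transposition is \<open>e\<close> with
  \<open>j\<close> replaced by \<open>i\<close>. Writing it this way makes the move an involution
  that also acts on whole cycles.\<close>

definition shift_edge :: "nat \<Rightarrow> nat \<Rightarrow> nat set set \<Rightarrow> nat set \<Rightarrow> nat set" where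
  "shift_edge i j E e =
     (if j \<in> e \<and> i \<notin> e \<and> transpose i j ` e \<notin> E then transpose i j ` e else e)"

definition shift :: "nat \<Rightarrow> nat \<Rightarrow> nat set set \<Rightarrow> nat set set" where
  "shift i j E = shift_edge i j E ` E"

lemma transpose_image_involutory [simp]: "transpose i j ` transpose i j ` e = e"
  by (simp add: image_image)

lemma transpose_image_same: "(i \<in> e \<longleftrightarrow> j \<in> e) \<Longrightarrow> transpose i j ` e = e"
  by (rule transpose_image_eq)

lemma mem_transpose_image: "x \<in> transpose i j ` e \<longleftrightarrow> transpose i j x \<in> e"
  by (metis image_eqI image_iff transpose_involutory)

lemma inj_on_shift_edge: "inj_on (shift_edge i j E) E"
proof (rule inj_onI)
  fix e f assume "e \<in> E" "f \<in> E" "shift_edge i j E e = shift_edge i j E f"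
  then show "e = f"
    unfolding shift_edge_def by (metis transpose_image_involutory)
qed

lemma card_shift: "card (shift i j E) = card E"
  unfolding shift_def using inj_on_shift_edge by (rule card_image)

lemma transpose_image_pairs:
  assumes "i \<in> V" "j \<in> V" "e \<in> pairs V"
  shows "transpose i j ` e \<in> pairs V"
  using assms(3)
proof (rule pairsE)
  fix x y assume "e = {x, y}" "x \<in> V" "y \<in> V" "x \<noteq> y"
  then show ?thesis using assms(1,2) 
    by (auto simp: doubleton_pairs transpose_eq_iff) (auto simp: transpose_def)
qed

lemma shift_subset_pairs:
  assumes "i \<in> V" "j \<in> V" "E \<subseteq> pairs V"
  shows "shift i j E \<subseteq> pairs V"
  using assms transpose_image_pairs[OF assms(1,2)] by (auto simp: shift_def shift_edge_def)

lemma shift_memD: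
  assumes "e \<in> shift i j E"
  shows "e \<in> E \<or> transpose i j ` e \<in> E"
  using assms unfolding shift_def shift_edge_def by (auto split: if_splits)

text \<open>Moved edges contain \<open>i\<close> but not \<open>j\<close>, so \<open>e\<close> was
  already in \<open>E\<close> and stayed in place. If it contains \<open>j\<close> without
  \<open>i\<close>, it can have stayed only because its transposed copy was present too; otherwise
  the two copies coincide.\<close>

lemma shift_memD_both:
  assumes "e \<in> shift i j E" "i \<in> e \<Longrightarrow> j \<in> e"
  shows "e \<in> E" "transpose i j ` e \<in> E"
proof -
  obtain f where f: "f \<in> E" "e = shift_edge i j E f" using assms(1) by (auto simp: shift_def)
  have "e = f"
  proof (rule ccontr)
    assume "e \<noteq> f"
    then have "j \<in> f" "i \<notin> f" "e = transpose i j ` f"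
      using f by (auto simp: shift_edge_def split: if_splits)
    then have "i \<in> e" "j \<notin> e" by (simp_all add: mem_transpose_image)
    then show False using assms(2) by simp
  qed
  then show "e \<in> E" using f by simp
  show "transpose i j ` e \<in> E"
  proof (cases "j \<in> e \<and> i \<notin> e")
    case True
    show ?thesis
    proof (rule ccontr)
      assume "transpose i j ` e \<notin> E"
      then have "e = transpose i j ` e" using True f \<open>e = f\<close> by (auto simp: shift_edge_def)
      then show False using True mem_transpose_image[of i i j e] by simp
    qed
  next
    case False
    then have "transpose i j ` e = e" using assms(2) by (intro transpose_image_same) blast
    then show ?thesis using \<open>e \<in> E\<close> by simp
  qed
qed

lemma shift_memI_fixed: "e \<in> E \<Longrightarrow> j \<notin> e \<or> i \<in> e \<Longrightarrow> e \<in> shift i j E"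
  unfolding shift_def shift_edge_def by (force intro: image_eqI[of _ _ e])

lemma shift_memI_both: "e \<in> E \<Longrightarrow> transpose i j ` e \<in> E \<Longrightarrow> e \<in> shift i j E"
  unfolding shift_def shift_edge_def by (force intro: image_eqI[of _ _ e])

lemma shift_memI_moved:
  assumes "transpose i j ` e \<in> E" "i \<in> e" "j \<notin> e"
  shows "e \<in> shift i j E"
proof (cases "e \<in> E")
  case True
  then show ?thesis using assms shift_memI_fixed by blast
next
  case False
  have "e = shift_edge i j E (transpose i j ` e)"
    using False assms by (simp add: shift_edge_def mem_transpose_image)
  then show ?thesis using assms(1) unfolding shift_def by blast
qed

text \<open>Edge counts are unchanged, so only the clique has to be followed. If it avoids
  \<open>i\<close>, the shifted graph has a clique avoiding \<open>j\<close> instead. If it avoids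
  \<open>u \<noteq> i\<close>, it survives, because for each of its edges that could move the target
  is again an edge of the clique.\<close>

lemma admissible_shift:
  assumes "admissible n E" "i \<in> {1..n}" "j \<in> {1..n}" "i \<noteq> j"
  shows "admissible n (shift i j E)"
proof -
  have "\<exists>u\<in>{1..n}. pairs ({1..n} - {u}) \<subseteq> shift i j E"
    if "u \<in> {1..n}" and u: "pairs ({1..n} - {u}) \<subseteq> E" for u
  proof (cases "u = i")
    case True
    have "pairs ({1..n} - {j}) \<subseteq> shift i j E"
    proof
      fix e assume e: "e \<in> pairs ({1..n} - {j})"
      then have j: "j \<notin> e" and e': "e \<in> pairs {1..n}" by (auto simp: pairs_def)
      have "i \<notin> transpose i j ` e" using j by (simp add: mem_transpose_image)
      moreover have "transpose i j ` e \<in> pairs {1..n}"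
        using transpose_image_pairs assms e' by blast
      ultimately have "transpose i j ` e \<in> E" using u True by (auto simp: pairs_def)
      then show "e \<in> shift i j E"
        using j shift_memI_moved[of i j e E] shift_memI_fixed[of e E j i]
          transpose_image_same[of i e j] by (cases "i \<in> e") auto
    qed
    then show ?thesis using assms(3) by blast
  next
    case False
    have "pairs ({1..n} - {u}) \<subseteq> shift i j E"
    proof
      fix e assume e: "e \<in> pairs ({1..n} - {u})"
      then have eE: "e \<in> E" using u by blast
      show "e \<in> shift i j E"
      proof (cases "j \<in> e \<and> i \<notin> e")
        case True
        then have "i \<in> {1..n} - {u}" "j \<in> {1..n} - {u}"
          using e False assms by (auto simp: pairs_def)
        then have "transpose i j ` e \<in> E" using transpose_image_pairs[OF _ _ e] u by blast
        then show ?thesis using eE shift_memI_both by blast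
      qed (use eE shift_memI_fixed in blast)
    qed
    then show ?thesis using that(1) by blast
  qed
  moreover have "graph_on n (shift i j E)"
    using assms shift_subset_pairs by (auto simp: admissible_def graph_on_pairs)
  ultimately show ?thesis using assms(1) unfolding admissible_def card_shift dense_def by blast
qed

text \<open>Serves as termination measure: a moved edge trades \<open>j\<close> for the smaller
  \<open>i\<close>.\<close>

definition weight :: "nat set set \<Rightarrow> nat" where
  "weight E = (\<Sum>e\<in>E. \<Sum>e)"

lemma weight_shift:
  assumes "i < j" "E \<subseteq> pairs V" "finite V"
  shows "weight (shift i j E) \<le> weight E"
    and "shift i j E \<noteq> E \<Longrightarrow> weight (shift i j E) < weight E"
proof -
  have fin: "finite E" using assms finite_pairs finite_subset by blast
  have w: "weight (shift i j E) = (\<Sum>e\<in>E. \<Sum>(shift_edge i j E e))"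
    unfolding weight_def shift_def by (simp add: sum.reindex[OF inj_on_shift_edge] o_def)
  have lt: "\<Sum>(shift_edge i j E e) < \<Sum>e" if eE: "e \<in> E" and ne: "shift_edge i j E e \<noteq> e" for e
  proof -
    have e: "j \<in> e" "i \<notin> e" "shift_edge i j E e = transpose i j ` e"
      using ne by (auto simp: shift_edge_def split: if_splits)
    obtain p q where "e = {p, q}" "p \<noteq> q" using eE assms(2) by (blast elim: pairsE)
    then obtain x where x: "e = {j, x}" "x \<noteq> j" "x \<noteq> i" using e by blast
    then have "transpose i j ` e = {i, x}" by simp
    then show ?thesis using e(3) x assms(1) by simp
  qed
  have le: "\<Sum>(shift_edge i j E e) \<le> \<Sum>e" if "e \<in> E" for e
    using lt[OF that] by (cases "shift_edge i j E e = e") auto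
  show "weight (shift i j E) \<le> weight E"
    unfolding w by (simp add: weight_def sum_mono le)
  assume "shift i j E \<noteq> E"
  then obtain e where "e \<in> E" "shift_edge i j E e \<noteq> e"
    unfolding shift_def by (metis (no_types, lifting) image_cong image_ident)
  then have "(\<Sum>e\<in>E. \<Sum>(shift_edge i j E e)) < (\<Sum>e\<in>E. \<Sum>e)"
    using fin le lt by (intro sum_strict_mono_ex1) auto
  then show "weight (shift i j E) < weight E" unfolding w by (simp add: weight_def)
qed

text \<open>Start the cycle at \<open>i\<close>. Every edge not at \<open>i\<close> lies in its
  original graph both as it is and with \<open>i\<close> and \<open>j\<close> exchanged; each of the
  two edges at \<open>i\<close> lies there in at least one of these forms. If the same form works
  for both, the cycle or its transposed image is rainbow.\<close>

lemma rainbow_ham_cycle_shift: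
  assumes "i \<in> {1..n}" "j \<in> {1..n}" "i \<noteq> j"
    and "rainbow_ham_cycle n (\<lambda>c. shift i j (G c))"
  shows "rainbow_ham_cycle n G"
proof -
  let ?\<pi> = "transpose i j"
  obtain v t where v: "bij_betw v {0..<n} {1..n}" and t: "bij_betw t {0..<n} {1..n}"
    and v0: "v 0 = i" and S: "\<And>k. k < n \<Longrightarrow> {v k, v ((k + 1) mod n)} \<in> shift i j (G (t k))"
    using rainbow_ham_cycle_startE[OF assms(4,1)] by blast
  define e where "e k = {v k, v ((k + 1) mod n)}" for k
  have n: "n \<ge> 2" using assms by auto
  have inj: "v k = v l \<longleftrightarrow> k = l" if "k < n" "l < n" for k l
    using v that by (auto simp: bij_betw_def inj_on_def)
  have once: "e k \<in> G (t k) \<or> ?\<pi> ` e k \<in> G (t k)" if "k < n" for k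
    using S[OF that] shift_memD unfolding e_def by blast
  have both: "e k \<in> G (t k)" "?\<pi> ` e k \<in> G (t k)" if "k < n" "k \<noteq> 0" "k \<noteq> n - 1" for k
  proof -
    have "v ((k + 1) mod n) \<noteq> v 0" "v k \<noteq> v 0" using inj that by auto
    then have "i \<notin> e k" using v0 by (auto simp: e_def)
    then show "e k \<in> G (t k)" "?\<pi> ` e k \<in> G (t k)"
      using S[OF that(1)] shift_memD_both unfolding e_def by blast+
  qed
  have pi: "bij_betw ?\<pi> {1..n} {1..n}"
    using assms(1,2)
    by (intro bij_betw_byWitness[where f' = "transpose i j"]) (auto simp: transpose_def)
  have \<pi>v: "bij_betw (?\<pi> \<circ> v) {0..<n} {1..n}" using v pi by (rule bij_betw_trans)
  consider "e 0 \<in> G (t 0)" "e (n - 1) \<in> G (t (n - 1))"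
    | "?\<pi> ` e 0 \<in> G (t 0)" "?\<pi> ` e (n - 1) \<in> G (t (n - 1))"
    | "?\<pi> ` e 0 \<in> G (t 0)" "e (n - 1) \<in> G (t (n - 1))"
    | "e 0 \<in> G (t 0)" "?\<pi> ` e (n - 1) \<in> G (t (n - 1))"
    using once[of 0] once[of "n - 1"] n by auto
  then show ?thesis
  proof cases
    case 1
    then have "e k \<in> G (t k)" if "k < n" for k using both that by metis
    then show ?thesis using v t by (intro rainbow_ham_cycleI[of v n t]) (auto simp: e_def)
  next
    case 2
    then have "?\<pi> ` e k \<in> G (t k)" if "k < n" for k using both that by metis
    then show ?thesis using \<pi>v t by (intro rainbow_ham_cycleI[of "?\<pi> \<circ> v" n t]) (auto simp: e_def)
  next
    text \<open>In the mixed cases, reversing the segment of the cycle between \<open>i\<close> and \<open>j\<close>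
      exchanges one neighbour of \<open>i\<close> with one neighbour of \<open>j\<close>.\<close>
    obtain m where m: "m < n" "v m = j"
      using v assms(2) by (metis atLeastLessThan_iff bij_betw_iff_bijections)
    have m0: "m > 0" using m v0 assms(3) by (cases m) auto
    \<comment> \<open>Transposing the reversed segment keeps \<open>i\<close> at position
      \<open>0\<close> and \<open>j\<close> at position \<open>m\<close>, so only its interior is
      reversed. Edges inside the segment are the transposed old ones (\<open>e1\<close>), those
      outside are unchanged (\<open>e2\<close>). The segment has edge positions \<open>0\<close> to
      \<open>m - 1\<close>, so colours are reflected by \<open>m - 1 - k\<close>.\<close>
    define v' where "v' k = (if k \<le> m then ?\<pi> (v (m - k)) else v k)" for k
    define t' where "t' k = (if k < m then t (m - 1 - k) else t k)" for k
    have v'_eq: "v' k = v (if 0 < k \<and> k < m then m - k else k)" if "k < n" for k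
    proof -
      have "v (m - k) \<noteq> v 0" "v (m - k) \<noteq> v m" if "0 < k" "k < m"
        using inj[of "m - k" 0] inj[of "m - k" m] m that by auto
      then have "?\<pi> (v (m - k)) = v (m - k)" if "0 < k" "k < m"
        using that v0 m by (simp add: transpose_apply_other)
      then show ?thesis using v0 m by (auto simp: v'_def)
    qed
    have "bij_betw (\<lambda>k. if 0 < k \<and> k < m then m - k else k) {0..<n} {0..<n}"
      by (rule bij_betw_byWitness[where f' = "\<lambda>k. if 0 < k \<and> k < m then m - k else k"])
        (use m in auto)
    from bij_betw_trans[OF this v] have v': "bij_betw v' {0..<n} {1..n}"
      by (subst bij_betw_cong[where g = "v \<circ> (\<lambda>k. if 0 < k \<and> k < m then m - k else k)"])
        (simp_all add: v'_eq)
    have "bij_betw (\<lambda>k. if k < m then m - 1 - k else k) {0..<n} {0..<n}"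
      by (rule bij_betw_byWitness[where f' = "\<lambda>k. if k < m then m - 1 - k else k"])
        (use m in auto)
    from bij_betw_trans[OF this t] have t': "bij_betw t' {0..<n} {1..n}"
      by (subst bij_betw_cong[where g = "t \<circ> (\<lambda>k. if k < m then m - 1 - k else k)"])
        (simp_all add: t'_def)
    have e1: "{v' k, v' ((k + 1) mod n)} = ?\<pi> ` e (m - 1 - k)" if "k < m" for k
    proof -
      have "(k + 1) mod n = k + 1" "(m - 1 - k + 1) mod n = m - k" using that m by auto
      moreover have "m - (k + 1) = m - 1 - k" by simp
      ultimately show ?thesis using that by (auto simp: e_def v'_def)
    qed
    have e2: "{v' k, v' ((k + 1) mod n)} = e k" if "k \<ge> m" "k < n" for k
    proof -
      have "v' k = v k" using v'_eq that by simp
      moreover have "v' ((k + 1) mod n) = v ((k + 1) mod n)"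
      proof (cases "k + 1 = n")
        case True
        then show ?thesis using v'_eq[of 0] that by simp
      next
        case False
        then show ?thesis using v'_eq[of "k + 1"] that by simp
      qed
      ultimately show ?thesis by (simp add: e_def)
    qed
    {
      case 3
      have "{v' k, v' ((k + 1) mod n)} \<in> G (t' k)" if "k < n" for k
      proof (cases "k < m")
        case True
        have "?\<pi> ` e (m - 1 - k) \<in> G (t (m - 1 - k))"
          using 3(1) both(2)[of "m - 1 - k"] m True by (cases "m - 1 - k = 0") auto
        then show ?thesis unfolding e1[OF True] using True by (simp add: t'_def)
      next
        case False
        have "e k \<in> G (t k)" using 3(2) both(1)[of k] m0 False that by (cases "k = n - 1") auto
        then show ?thesis using e2 False that by (simp add: t'_def)
      qed
      then show ?thesis using v' t' rainbow_ham_cycleI by blast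
    next
      case 4
      \<comment> \<open>Transposing the whole new cycle exchanges the roles: segment edges return to
        their old form and the edges outside become the transposed ones.\<close>
      have \<pi>v': "bij_betw (?\<pi> \<circ> v') {0..<n} {1..n}" using v' pi by (rule bij_betw_trans)
      have "{(?\<pi> \<circ> v') k, (?\<pi> \<circ> v') ((k + 1) mod n)} \<in> G (t' k)" if "k < n" for k
      proof -
        have eq: "{(?\<pi> \<circ> v') k, (?\<pi> \<circ> v') ((k + 1) mod n)} = ?\<pi> ` {v' k, v' ((k + 1) mod n)}"
          by simp
        show ?thesis
        proof (cases "k < m")
          case True
          have "e (m - 1 - k) \<in> G (t (m - 1 - k))"
            using 4(1) both(1)[of "m - 1 - k"] m True by (cases "m - 1 - k = 0") auto
          then show ?thesis unfolding eq e1[OF True] using True by (simp add: t'_def)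
        next
          case False
          have "?\<pi> ` e k \<in> G (t k)"
            using 4(2) both(2)[of k] m0 False that by (cases "k = n - 1") auto
          then show ?thesis unfolding eq using e2 False that by (simp add: t'_def)
        qed
      qed
      then show ?thesis using \<pi>v' t' rainbow_ham_cycleI by blast
    }
  qed
qed

section \<open>Fully compressed families and the zigzag cycle\<close>

definition stable :: "nat \<Rightarrow> nat set set \<Rightarrow> bool" where
  "stable n E \<longleftrightarrow> (\<forall>i\<in>{1..n}. \<forall>j\<in>{1..n}. i < j \<longrightarrow> shift i j E = E)"

lemma stable_lower:
  assumes "stable n E" "{x, j} \<in> E" "i < j" "i \<noteq> x" "i \<in> {1..n}" "j \<in> {1..n}" "x \<noteq> j"
  shows "{x, i} \<in> E"
proof -
  have "{x, i} \<in> shift i j E"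
  proof (rule shift_memI_moved)
    have "transpose i j ` {x, i} = {x, j}" using assms by simp
    then show "transpose i j ` {x, i} \<in> E" using assms(2) by simp
    show "j \<notin> {x, i}" using assms by auto
  qed simp
  then show ?thesis using assms by (auto simp: stable_def)
qed

text \<open>An edge \<open>{x, y}\<close> could be lowered to \<open>{a, b}\<close> one endpoint at
  a time. The order depends on whether \<open>x < b\<close>, so that the two endpoints never
  coincide on the way.\<close>

lemma stable_nonedge_upward:
  assumes st: "stable n E" and "{a, b} \<notin> E" "1 \<le> a" "a < b" "a \<le> x" "b \<le> y" "x < y" "y \<le> n"
  shows "{x, y} \<notin> E"
proof
  assume xy: "{x, y} \<in> E"
  have "{a, b} \<in> E"
  proof (cases "x < b")
    case True
    have "{x, b} \<in> E"
      using stable_lower[OF st xy, of b] xy True assms by (cases "b = y") auto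
    then have bx: "{b, x} \<in> E" by (simp add: insert_commute)
    have "{b, a} \<in> E"
      using stable_lower[OF st bx, of a] bx True assms by (cases "a = x") auto
    then show ?thesis by (simp add: insert_commute)
  next
    case False
    have yx: "{y, x} \<in> E" using xy by (simp add: insert_commute)
    have "{y, a} \<in> E" using stable_lower[OF st yx, of a] False assms by auto
    then have ay: "{a, y} \<in> E" by (simp add: insert_commute)
    show ?thesis using stable_lower[OF st ay, of b] ay assms by (cases "b = y") auto
  qed
  then show False using assms by simp
qed

text \<open>A missing edge forces a hook of missing edges: \<open>a\<close> with
  \<open>b, ..., n - 1\<close>, and \<open>n\<close> with \<open>a, ..., n - 1\<close>. The
  half-open ranges count \<open>{a, n}\<close> only once.\<close>

lemma stable_nonedge_count:
  assumes st: "stable n E" and E: "E \<subseteq> pairs {1..n}"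
    and ab: "{a, b} \<notin> E" "1 \<le> a" "a < b" "b \<le> n"
  shows "card E + (2 * n - (a + b)) \<le> n choose 2"
proof -
  define A where "A = (\<lambda>y. {a, y}) ` {b..<n}"
  define B where "B = (\<lambda>x. {x, n}) ` {a..<n}"
  have cA: "card A = n - b" unfolding A_def
    by (subst card_image) (auto simp: inj_on_def doubleton_eq_iff)
  have cB: "card B = n - a" unfolding B_def
    by (subst card_image) (auto simp: inj_on_def doubleton_eq_iff)
  have "A \<inter> B = {}" using ab unfolding A_def B_def by (auto simp: doubleton_eq_iff)
  moreover have fin: "finite A" "finite B" "finite E"
    using E finite_pairs finite_subset by (auto simp: A_def B_def)
  moreover have "A \<inter> E = {}" "B \<inter> E = {}"
    using stable_nonedge_upward[OF st ab(1-3)] ab unfolding A_def B_def by auto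
  ultimately have "card (E \<union> (A \<union> B)) = card E + (card A + card B)"
    by (subst card_Un_disjoint; auto)+
  moreover have "E \<union> (A \<union> B) \<subseteq> pairs {1..n}"
    using E ab by (auto simp: A_def B_def doubleton_pairs)
  then have "card (E \<union> (A \<union> B)) \<le> card (pairs {1..n})"
    by (intro card_mono finite_pairs) auto
  then have "card (E \<union> (A \<union> B)) \<le> n choose 2" by (simp add: card_pairs)
  ultimately show ?thesis using cA cB ab by simp
qed

definition zigzag :: "nat \<Rightarrow> nat \<Rightarrow> nat" where
  "zigzag n k = (if even k then k div 2 + 1 else n - k div 2)"

lemma bij_betw_zigzag: "bij_betw (zigzag n) {0..<n} {1..n}"
proof -
  have "inj_on (zigzag n) {0..<n}"
  proof (rule inj_onI)
    fix x y assume "x \<in> {0..<n}" "y \<in> {0..<n}" "zigzag n x = zigzag n y"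
    then show "x = y"
      by (auto simp: zigzag_def elim!: evenE oddE split: if_splits)
  qed
  moreover have "zigzag n ` {0..<n} \<subseteq> {1..n}"
    by (auto simp: zigzag_def)
  ultimately show ?thesis unfolding bij_betw_def by (simp add: card_image card_subset_eq)
qed

text \<open>Sums of consecutive entries alternate between \<open>n + 1\<close> and
  \<open>n + 2\<close>, and the closing edge returns to vertex \<open>1\<close>.\<close>

lemma zigzag_consecutive_sum:
  assumes "k < n"
  shows "zigzag n k + zigzag n ((k + 1) mod n) \<le> n + 2"
proof (cases "k + 1 = n")
  case True
  have "zigzag n k \<le> n"
    using bij_betw_zigzag[of n] assms by (auto dest!: bij_betwE)
  then show ?thesis using True by (simp add: zigzag_def)
next
  case False
  then have "(k + 1) mod n = k + 1" using assms by simp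
  then show ?thesis using assms by (auto simp: zigzag_def elim!: evenE oddE)
qed

text \<open>By \<open>stable_nonedge_count\<close>, a missing edge with
  \<open>a + b \<le> n + 2\<close> comes with at least \<open>n - 2\<close> missing edges, which a
  dense graph excludes. If the edge is \<open>{1, n}\<close>, even \<open>n - 1\<close> are missing,
  too many for an admissible graph. Hence only \<open>{2, n}\<close> remains once
  \<open>b < n\<close> is excluded.\<close>

lemma rainbow_of_stable:
  assumes n: "n \<ge> 4"
    and adm: "\<forall>c\<in>{1..n}. admissible n (G c)" and st: "\<forall>c\<in>{1..n}. stable n (G c)"
    and c0: "c0 \<in> {1..n}" "dense n (G c0)"
  shows "rainbow_ham_cycle n G"
proof -
  let ?v = "zigzag n"
  have good: "{a, b} \<in> G c"
    if c: "c \<in> {1..n}" and ab: "1 \<le> a" "a < b" "b \<le> n" "a + b \<le> n + 2"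
      and ex: "dense n (G c) \<or> (a, b) \<noteq> (2, n)" for a b c
  proof (rule ccontr)
    assume non: "{a, b} \<notin> G c"
    have sub: "G c \<subseteq> pairs {1..n}" using adm c by (simp add: admissible_def graph_on_pairs)
    have st': "stable n (G c)" using st c by blast
    have cnt: "card (G c) + (2 * n - (a + b)) \<le> n choose 2"
      by (rule stable_nonedge_count[OF st' sub non ab(1-3)])
    then have nd: "\<not> dense n (G c)" using ab by (simp add: dense_def)
    have big: "card (G c) + n \<ge> (n choose 2) + 2" using adm c by (simp add: admissible_def)
    obtain u where u: "u \<in> {1..n}" "pairs ({1..n} - {u}) \<subseteq> G c"
      using adm c nd by (auto simp: admissible_def)
    show False
    proof (cases "b = n")
      case True
      then have "a = 1 \<or> a = 2" using ab by auto
      then show False using True ex nd cnt big n by auto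
    next
      case False
      \<comment> \<open>The triangle on \<open>a\<close>, \<open>b\<close>, \<open>n\<close> is
        entirely missing, but a clique on all vertices except \<open>u\<close> contains at least one
        of its edges.\<close>
      then have "{a, n} \<notin> G c" "{b, n} \<notin> G c"
        using stable_nonedge_upward[OF st' non ab(1,2)] ab by auto
      then have "{a, b} \<notin> pairs ({1..n} - {u})" "{a, n} \<notin> pairs ({1..n} - {u})"
        "{b, n} \<notin> pairs ({1..n} - {u})" using non u by blast+
      then show False using ab False by (auto simp: doubleton_pairs)
    qed
  qed
  \<comment> \<open>Position \<open>1\<close> of the zigzag cycle carries the edge
    \<open>{n, 2}\<close>, the only one that may be missing somewhere, so the dense graph is placed
    there.\<close>
  obtain t where t: "bij_betw t {0..<n} {1..n}" "t 1 = c0"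
    using ex_bij_betw_extending[of "{0..<n}" "{1..n}" "{1}" "\<lambda>_. c0"] n c0(1) by auto
  have inj: "?v k = ?v l \<longleftrightarrow> k = l" if "k < n" "l < n" for k l
    using bij_betw_zigzag[of n] that by (auto simp: bij_betw_def inj_on_def)
  show ?thesis
  proof (rule rainbow_ham_cycleI[OF bij_betw_zigzag t(1)])
    fix k assume k: "k < n"
    define l where "l = (k + 1) mod n"
    have l: "l < n" "k \<noteq> l" using n k by (auto simp: l_def mod_Suc)
    have V: "?v k \<in> {1..n}" "?v l \<in> {1..n}"
      using bij_betw_zigzag[of n] k l by (auto dest!: bij_betwE)
    have ne: "?v k \<noteq> ?v l" using inj k l by simp
    have sum: "?v k + ?v l \<le> n + 2" using zigzag_consecutive_sum[OF k] by (simp add: l_def)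
    have c: "t k \<in> {1..n}" using t(1) k by (auto dest: bij_betwE)
    have v12: "?v 1 = n" "?v 2 = 2" by (simp_all add: zigzag_def)
    have k1: "k = 1" if "{?v k, ?v l} = {2, n}"
    proof -
      have "(?v k = ?v 2 \<and> ?v l = ?v 1) \<or> (?v k = ?v 1 \<and> ?v l = ?v 2)"
        using that v12 by (auto simp: doubleton_eq_iff)
      then have "(k = 2 \<and> l = 1) \<or> k = 1" using inj k l n by auto
      moreover have "l = 3" if "k = 2" using that n by (simp add: l_def)
      ultimately show ?thesis by auto
    qed
    have dense: "dense n (G (t k)) \<or> {?v k, ?v l} \<noteq> {2, n}" using k1 t(2) c0(2) by auto
    have "{?v k, ?v l} \<in> G (t k)"
    proof (cases "?v k < ?v l")
      case True
      show ?thesis by (rule good[OF c]) (use True V sum dense in auto)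
    next
      case False
      have "{?v l, ?v k} \<in> G (t k)"
        by (rule good[OF c]) (use False ne V sum dense in \<open>auto simp: insert_commute\<close>)
      then show ?thesis by (simp add: insert_commute)
    qed
    then show "{?v k, ?v ((k + 1) mod n)} \<in> G (t k)" by (simp add: l_def)
  qed
qed

text \<open>Induction on the total weight. A shift that changes some graph is applied to all graphs
  at once, and the rainbow cycle of the shifted family is pulled back by
  \<open>rainbow_ham_cycle_shift\<close>.\<close>

lemma rainbow_of_dense:
  assumes "n \<ge> 4" "\<forall>c\<in>{1..n}. admissible n (G c)" "c0 \<in> {1..n}" "dense n (G c0)"
  shows "rainbow_ham_cycle n G"
  using assms(2,4)
proof (induction "\<Sum>c\<in>{1..n}. weight (G c)" arbitrary: G rule: less_induct)
  case less
  show ?case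
  proof (cases "\<forall>c\<in>{1..n}. stable n (G c)")
    case True
    then show ?thesis using rainbow_of_stable less.prems assms by blast
  next
    case False
    then obtain c i j where c: "c \<in> {1..n}" and ij: "i \<in> {1..n}" "j \<in> {1..n}" "i < j"
      and ne: "shift i j (G c) \<noteq> G c" unfolding stable_def by blast
    have sub: "G d \<subseteq> pairs {1..n}" if "d \<in> {1..n}" for d
      using less.prems(1) that by (simp add: admissible_def graph_on_pairs)
    have "(\<Sum>d\<in>{1..n}. weight (shift i j (G d))) < (\<Sum>d\<in>{1..n}. weight (G d))"
    proof (rule sum_strict_mono_ex1)
      show "\<forall>d\<in>{1..n}. weight (shift i j (G d)) \<le> weight (G d)"
        using weight_shift(1)[OF ij(3) sub] by simp
      show "\<exists>d\<in>{1..n}. weight (shift i j (G d)) < weight (G d)"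
        using weight_shift(2)[OF ij(3) sub[OF c] _ ne] c by blast
    qed simp
    moreover have "\<forall>d\<in>{1..n}. admissible n (shift i j (G d))"
      using less.prems(1) admissible_shift ij by simp
    moreover have "dense n (shift i j (G c0))" using less.prems(2) by (simp add: dense_def card_shift)
    ultimately have "rainbow_ham_cycle n (\<lambda>d. shift i j (G d))"
      by (rule less.hyps)
    then show ?thesis using rainbow_ham_cycle_shift ij by blast
  qed
qed

section \<open>Cliques with a pendant edge\<close>

definition pendant_clique :: "nat \<Rightarrow> nat \<Rightarrow> nat \<Rightarrow> nat set set" where
  "pendant_clique n u w = insert {u, w} (pairs ({1..n} - {u}))"

text \<open>The two edge bounds leave exactly one edge outside the clique, and this edge must
  contain \<open>u\<close>.\<close>

lemma admissible_not_denseE: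
  assumes "n \<ge> 1" "admissible n E" "\<not> dense n E"
  obtains u w where "u \<in> {1..n}" "w \<in> {1..n}" "w \<noteq> u" "E = pendant_clique n u w"
proof -
  obtain u where u: "u \<in> {1..n}" "pairs ({1..n} - {u}) \<subseteq> E"
    using assms by (auto simp: admissible_def)
  let ?K = "pairs ({1..n} - {u})"
  have sub: "E \<subseteq> pairs {1..n}" using assms(2) by (simp add: admissible_def graph_on_pairs)
  have "card ?K = (n - 1) choose 2" using u(1) by (simp add: card_pairs)
  moreover have "card E = ((n - 1) choose 2) + 1"
    using assms choose_two_pred[of n] by (auto simp: admissible_def dense_def)
  ultimately have "card (E - ?K) = 1"
    using u(2) by (simp add: card_Diff_subset finite_pairs)
  then obtain e where e: "E - ?K = {e}" by (auto simp: card_1_singleton_iff)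
  then have "e \<in> pairs {1..n}" "e \<notin> ?K" using sub by auto
  then obtain p q where pq: "e = {p, q}" "p \<in> {1..n}" "q \<in> {1..n}" "p \<noteq> q" "p = u \<or> q = u"
    by (auto elim!: pairsE simp: doubleton_pairs)
  have E: "E = insert e ?K" using e u(2) by auto
  show thesis
  proof (cases "p = u")
    case True
    then show thesis using that[of u q] pq E u(1) by (simp add: pendant_clique_def)
  next
    case False
    then show thesis using that[of u p] pq E u(1) by (simp add: pendant_clique_def insert_commute)
  qed
qed

text \<open>Let \<open>p\<close> have the neighbours \<open>x\<close> and \<open>y\<close> on the
  cycle and colour its two edges \<open>a\<close> and \<open>b\<close>. The other edges avoid
  \<open>p\<close>, so any order of the remaining vertices and colours works.\<close>

lemma rainbow_through_vertex:
  assumes n: "n \<ge> 3" and p: "p \<in> {1..n}" and ab: "a \<in> {1..n}" "b \<in> {1..n}" "a \<noteq> b"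
    and xy: "x \<in> {1..n} - {p}" "y \<in> {1..n} - {p}" "x \<noteq> y"
    and "{p, x} \<in> G a" "{p, y} \<in> G b"
    and rest: "\<And>c. c \<in> {1..n} - {a, b} \<Longrightarrow> pairs ({1..n} - {p}) \<subseteq> G c"
  shows "rainbow_ham_cycle n G"
proof -
  let ?f = "\<lambda>k. if k = 0 then p else if k = 1 then x else y"
  obtain v where v: "bij_betw v {0..<n} {1..n}"
    and vf: "\<And>k. k \<in> {0, 1, n - 1} \<Longrightarrow> v k = ?f k"
    by (rule ex_bij_betw_extending[of "{0..<n}" "{1..n}" "{0, 1, n - 1}" ?f])
      (use n p xy in \<open>auto simp: inj_on_def\<close>)
  let ?g = "\<lambda>k. if k = 0 then a else b"
  obtain t where t: "bij_betw t {0..<n} {1..n}"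
    and tg: "\<And>k. k \<in> {0, n - 1} \<Longrightarrow> t k = ?g k"
    by (rule ex_bij_betw_extending[of "{0..<n}" "{1..n}" "{0, n - 1}" ?g])
      (use n ab in \<open>auto simp: inj_on_def\<close>)
  have v0: "v 0 = p" "v 1 = x" "v (n - 1) = y" using vf[of 0] vf[of 1] vf[of "n - 1"] n by auto
  have t0: "t 0 = a" "t (n - 1) = b" using tg[of 0] tg[of "n - 1"] n by auto
  have inj: "v k = v l \<longleftrightarrow> k = l" "t k = t l \<longleftrightarrow> k = l" if "k < n" "l < n" for k l
    using inj_on_eq_iff[OF bij_betw_imp_inj_on[OF v]] inj_on_eq_iff[OF bij_betw_imp_inj_on[OF t]]
      that by simp_all
  show ?thesis
  proof (rule rainbow_ham_cycleI[OF v t])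
    fix k assume k: "k < n"
    consider "k = 0" | "k = n - 1" | "0 < k" "k < n - 1" using k by linarith
    then show "{v k, v ((k + 1) mod n)} \<in> G (t k)"
    proof cases
      case 1
      then show ?thesis using n v0 t0 assms by simp
    next
      case 2
      then show ?thesis using n v0 t0 assms by (simp add: insert_commute)
    next
      case 3
      then have k': "(k + 1) mod n = k + 1" "k + 1 < n" by auto
      have "t k \<noteq> t 0" "t k \<noteq> t (n - 1)" using inj(2)[of k 0] inj(2)[of k "n - 1"] 3 k by auto
      then have "t k \<in> {1..n} - {a, b}" using t k t0 by (auto dest: bij_betwE)
      moreover have "v k \<noteq> v 0" "v (k + 1) \<noteq> v 0" "v k \<noteq> v (k + 1)"
        using inj(1)[of k 0] inj(1)[of "k + 1" 0] inj(1)[of k "k + 1"] 3 k' by auto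
      then have "{v k, v (k + 1)} \<in> pairs ({1..n} - {p})"
        using v k k' v0 by (auto simp: doubleton_pairs dest: bij_betwE)
      ultimately show ?thesis using rest k' by auto
    qed
  qed
qed

text \<open>List the colours so that equal centres are consecutive, place each centre at the position
  where its block starts, and give the colour of rank \<open>r\<close> the cycle edge of index \<open>r + 1\<close>.
  A block of at most \<open>n - 2\<close> colours never wraps around to the edges at its centre.\<close>

lemma rainbow_of_spread_centres:
  assumes u: "\<And>c. c \<in> {1..n} \<Longrightarrow> u c \<in> {1..n} \<and> pairs ({1..n} - {u c}) \<subseteq> G c"
    and n: "n \<ge> 3"
    and spread: "\<And>p. \<exists>a\<in>{1..n}. \<exists>b\<in>{1..n}. a \<noteq> b \<and> u a \<noteq> p \<and> u b \<noteq> p"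
  shows "rainbow_ham_cycle n G"
proof -
  define cs where "cs = sort_key u [1..<n + 1]"
  have len: "length cs = n" and set: "set cs = {1..n}" and dist: "distinct cs"
    by (auto simp: cs_def)
  have mono: "u (cs ! r) \<le> u (cs ! r')" if "r \<le> r'" "r' < n" for r r'
  proof -
    have "sorted (map u cs)" by (simp add: cs_def)
    then show ?thesis using sorted_nth_mono[of "map u cs" r r'] that len by simp
  qed
  have mem: "cs ! r \<in> {1..n}" if "r < n" for r using that len set by (metis nth_mem)
  \<comment> \<open>These are the first ranks of the blocks of equal centre, so \<open>f\<close> is
    injective on them and can be prescribed as part of the vertex order.\<close>
  define A where "A = {r. r < n \<and> (\<forall>r'<r. u (cs ! r') \<noteq> u (cs ! r))}"
  define f where "f r = u (cs ! r)" for r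
  have inj_f: "inj_on f A"
  proof (rule inj_onI)
    fix r r' assume "r \<in> A" "r' \<in> A" "f r = f r'"
    then show "r = r'" unfolding A_def f_def by (metis (mono_tags, lifting) mem_Collect_eq nat_neq_iff)
  qed
  obtain v where v: "bij_betw v {0..<n} {1..n}" and vA: "\<And>r. r \<in> A \<Longrightarrow> v r = f r"
    by (rule ex_bij_betw_extending[of "{0..<n}" "{1..n}" A f])
      (use inj_f u mem in \<open>auto simp: A_def f_def\<close>)
  have inj: "v k = v l \<longleftrightarrow> k = l" if "k < n" "l < n" for k l
    using v that by (auto simp: bij_betw_def inj_on_def)
  have good: "{v ((r + 1) mod n), v ((r + 2) mod n)} \<in> G (cs ! r)" if r: "r < n" for r
  proof -
    define p where "p = u (cs ! r)"
    define s where "s = (LEAST r'. u (cs ! r') = p)"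
    have s: "u (cs ! s) = p" unfolding s_def by (rule LeastI[of _ r]) (simp add: p_def)
    have sr: "s \<le> r" unfolding s_def by (rule Least_le) (simp add: p_def)
    have "s \<in> A" using s sr r not_less_Least[of _ "\<lambda>r'. u (cs ! r') = p"]
      unfolding A_def s_def[symmetric] by auto
    then have vs: "v s = p" using vA s by (simp add: f_def)
    have block: "u (cs ! q) = p" if "s \<le> q" "q \<le> r" for q
      using mono[of s q] mono[of q r] that r s p_def by simp
    \<comment> \<open>Two colours have a centre other than \<open>p\<close>, so they lie outside the
      ranks \<open>s, ..., r\<close> and at most \<open>n - 2\<close> ranks are left. Hence
      \<open>r + 2 < s + n\<close>, and positions \<open>r + 1\<close> and \<open>r + 2\<close>
      modulo \<open>n\<close> miss \<open>s\<close>.\<close>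
    have short: "r < s + (n - 2)"
    proof (rule ccontr)
      assume long: "\<not> r < s + (n - 2)"
      obtain a b where ab: "a \<in> set cs" "b \<in> set cs" "a \<noteq> b" "u a \<noteq> p" "u b \<noteq> p"
        using spread[of p] set by auto
      obtain ra rb where "ra < n" "a = cs ! ra" "rb < n" "b = cs ! rb"
        using ab(1,2) len by (metis in_set_conv_nth)
      moreover from this have "ra \<noteq> rb" "\<not> (s \<le> ra \<and> ra \<le> r)" "\<not> (s \<le> rb \<and> rb \<le> r)"
        using ab block by auto
      ultimately show False using long r n sr by linarith
    qed
    have "(r + 1) mod n = (if r + 1 < n then r + 1 else r + 1 - n)"
      "(r + 2) mod n = (if r + 2 < n then r + 2 else r + 2 - n)"
      using r n by (auto simp: le_mod_geq)
    then have "(r + 1) mod n \<noteq> s" "(r + 2) mod n \<noteq> s" "(r + 1) mod n \<noteq> (r + 2) mod n"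
      using short sr r n by auto
    moreover have "(r + 1) mod n < n" "(r + 2) mod n < n" "s < n" using n r sr by auto
    ultimately have "v ((r + 1) mod n) \<noteq> p" "v ((r + 2) mod n) \<noteq> p"
      "v ((r + 1) mod n) \<noteq> v ((r + 2) mod n)"
      "v ((r + 1) mod n) \<in> {1..n}" "v ((r + 2) mod n) \<in> {1..n}"
      using inj vs v by (auto dest: bij_betwE)
    then have "{v ((r + 1) mod n), v ((r + 2) mod n)} \<in> pairs ({1..n} - {p})"
      by (simp add: doubleton_pairs)
    then show ?thesis using u[OF mem[OF r]] p_def by blast
  qed
  \<comment> \<open>Adding \<open>n - 1\<close> modulo \<open>n\<close> subtracts one: position
    \<open>k\<close> receives the colour of rank \<open>k - 1\<close>.\<close>
  define t where "t k = cs ! ((k + (n - 1)) mod n)" for k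
  have "bij_betw ((!) cs) {0..<n} {1..n}"
    using bij_betw_nth[OF dist, of "{0..<n}" "{1..n}"] len set by (simp add: atLeast0LessThan)
  moreover have "bij_betw (\<lambda>k. (k + (n - 1)) mod n) {0..<n} {0..<n}"
    using n by (intro bij_betw_mod_rotate) simp
  ultimately have "bij_betw ((!) cs \<circ> (\<lambda>k. (k + (n - 1)) mod n)) {0..<n} {1..n}"
    by (rule bij_betw_trans[rotated])
  then have t: "bij_betw t {0..<n} {1..n}" unfolding t_def[abs_def] o_def .
  show ?thesis
  proof (rule rainbow_ham_cycleI[OF v t])
    fix k assume k: "k < n"
    define r where "r = (k + (n - 1)) mod n"
    have "(r + 1) mod n = (k + n) mod n" "(r + 2) mod n = (k + 1 + n) mod n"
      using n by (simp_all add: r_def mod_simps)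
    then have "(r + 1) mod n = k" "(r + 2) mod n = (k + 1) mod n"
      using k by (simp_all only: mod_add_self2 mod_less)
    then show "{v k, v ((k + 1) mod n)} \<in> G (t k)" using good[of r] n by (simp add: t_def r_def)
  qed
qed

text \<open>Split by how many graphs have a pendant vertex other than a common \<open>p\<close>.
  With at least two for every \<open>p\<close>, \<open>rainbow_of_spread_centres\<close> applies.
  With none, two different pendant edges at \<open>p\<close> serve as the edges through
  \<open>p\<close>, unless all graphs are equal. With exactly one, its clique contains
  \<open>p\<close> and supplies one edge there, and a pendant edge of another graph supplies the
  second.\<close>

lemma rainbow_or_equal_pendant_cliques:
  assumes n: "n \<ge> 4"
    and uw: "\<And>c. c \<in> {1..n} \<Longrightarrow> u c \<in> {1..n} \<and> w c \<in> {1..n} \<and> w c \<noteq> u c \<and>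
              G c = pendant_clique n (u c) (w c)"
  shows "rainbow_ham_cycle n G \<or> (\<forall>c\<in>{1..n}. G c = G 1)"
proof -
  have K: "pairs ({1..n} - {u c}) \<subseteq> G c" and E: "{u c, w c} \<in> G c" if "c \<in> {1..n}" for c
    using uw[OF that] by (auto simp: pendant_clique_def)
  consider (spread) "\<forall>p. \<exists>a\<in>{1..n}. \<exists>b\<in>{1..n}. a \<noteq> b \<and> u a \<noteq> p \<and> u b \<noteq> p"
    | (const) p where "\<forall>c\<in>{1..n}. u c = p"
    | (almost) p a where "a \<in> {1..n}" "u a \<noteq> p" "\<forall>c\<in>{1..n} - {a}. u c = p"
    by blast
  then show ?thesis
  proof cases
    case spread
    then show ?thesis using rainbow_of_spread_centres[of n u G] uw K n by auto
  next
    case const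
    show ?thesis
    proof (cases "\<forall>c\<in>{1..n}. w c = w 1")
      case True
      have "G c = G 1" if "c \<in> {1..n}" for c
      proof -
        have one: "1 \<in> {1..n}" using n by simp
        have "u c = u 1" "w c = w 1" using const True that one by metis+
        then show ?thesis using uw[OF that] uw[OF one] by metis
      qed
      then show ?thesis by blast
    next
      case False
      then obtain a where a: "a \<in> {1..n}" "w a \<noteq> w 1" by blast
      have one: "1 \<in> {1..n}" using n by simp
      have "rainbow_ham_cycle n G"
        by (rule rainbow_through_vertex[of n p a 1 "w a" "w 1"])
          (use n a one const uw[OF a(1)] uw[OF one] E[OF a(1)] E[OF one] K in auto)
      then show ?thesis ..
    qed
  next
    case almost
    define b :: nat where "b = (if a = 1 then 2 else 1)"
    have b: "b \<in> {1..n}" "b \<noteq> a" using n by (auto simp: b_def)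
    then have ub: "u b = p" using almost by blast
    have p: "p \<in> {1..n}" using uw[OF b(1)] ub by simp
    \<comment> \<open>The second neighbour \<open>x\<close> of \<open>p\<close> must differ from
      \<open>p\<close> and \<open>w b\<close>, and from \<open>u a\<close> so that
      \<open>{p, x}\<close> lies in the clique of \<open>G a\<close>. Four vertices leave room for
      it.\<close>
    have "\<not> {1..n} \<subseteq> {p, w b, u a}"
    proof
      assume "{1..n} \<subseteq> {p, w b, u a}"
      then have "card {1..n} \<le> card {p, w b, u a}" by (intro card_mono) auto
      also have "\<dots> \<le> 3" by (simp add: card_insert_if)
      finally show False using n by simp
    qed
    then obtain x where x: "x \<in> {1..n}" "x \<noteq> p" "x \<noteq> w b" "x \<noteq> u a" by blast
    have "{p, x} \<in> pairs ({1..n} - {u a})" using x p almost by (auto simp: doubleton_pairs)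
    then have px: "{p, x} \<in> G a" using K almost by blast
    have "rainbow_ham_cycle n G"
    proof (rule rainbow_through_vertex[of n p a b x "w b"])
      show "pairs ({1..n} - {p}) \<subseteq> G c" if "c \<in> {1..n} - {a, b}" for c
        using K[of c] almost that by auto
    qed (use n p almost b x px uw[OF b(1)] E[OF b(1)] ub in auto)
    then show ?thesis ..
  qed
qed

section \<open>The extremal graph and the conclusion\<close>

text \<open>Any bijection sending \<open>u\<close> to \<open>n\<close> and \<open>w\<close> to
  \<open>1\<close> works, since an injective map carries all pairs of a set onto all pairs of its
  image.\<close>

lemma pendant_clique_iso:
  assumes "n \<ge> 2" "u \<in> {1..n}" "w \<in> {1..n}" "w \<noteq> u"
  shows "graph_iso n (pendant_clique n u w) (K1_join_Kn2_K1 n)"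
proof -
  obtain f where f: "bij_betw f {1..n} {1..n}"
    and fA: "\<And>x. x \<in> {u, w} \<Longrightarrow> f x = (if x = u then n else 1)"
    by (rule ex_bij_betw_extending[of "{1..n}" "{1..n}" "{u, w}" "\<lambda>x. if x = u then n else 1"])
      (use assms in \<open>auto simp: inj_on_def\<close>)
  have fuw: "f u = n" "f w = 1" using fA assms by auto
  have K1: "K1_join_Kn2_K1 n = insert {1, n} (pairs {1..n - 1})"
    by (auto simp: K1_join_Kn2_K1_def doubleton_pairs elim!: pairsE)
  have inj: "inj_on f {1..n}" and im: "f ` {1..n} = {1..n}" using f by (auto simp: bij_betw_def)
  have "f ` ({1..n} - {u}) = f ` {1..n} - f ` {u}"
    using inj assms by (intro inj_on_image_set_diff[of f "{1..n}"]) auto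
  also have "\<dots> = {1..n - 1}" using im fuw by auto
  finally have im': "f ` ({1..n} - {u}) = {1..n - 1}" .
  have "(`) f ` pairs ({1..n} - {u}) = pairs (f ` ({1..n} - {u}))" (is "?L = ?R")
  proof
    have "f ` e \<in> ?R" if e: "e \<in> pairs ({1..n} - {u})" for e
    proof -
      obtain x y where xy: "e = {x, y}" "x \<in> {1..n} - {u}" "y \<in> {1..n} - {u}" "x \<noteq> y"
        using e by (rule pairsE)
      then have "f x \<noteq> f y" using inj_on_eq_iff[OF inj] by simp
      then show ?thesis using xy by (auto simp: doubleton_pairs)
    qed
    then show "?L \<subseteq> ?R" by blast
    show "?R \<subseteq> ?L"
    proof
      fix e assume "e \<in> ?R"
      then obtain x' y' where "e = {x', y'}" "x' \<in> f ` ({1..n} - {u})"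
        "y' \<in> f ` ({1..n} - {u})" "x' \<noteq> y'" by (rule pairsE)
      then obtain x y where "e = f ` {x, y}" "x \<in> {1..n} - {u}" "y \<in> {1..n} - {u}" "x \<noteq> y"
        by (elim imageE) (metis image_empty image_insert)
      moreover from this have "{x, y} \<in> pairs ({1..n} - {u})" by (simp add: doubleton_pairs)
      ultimately show "e \<in> ?L" by blast
    qed
  qed
  then have "K1_join_Kn2_K1 n = (`) f ` pendant_clique n u w"
    unfolding K1 pendant_clique_def im' by (simp add: fuw insert_commute)
  then show ?thesis using f unfolding graph_iso_def by blast
qed

theorem mainTheorem2:
  fixes n :: nat and G :: "nat \<Rightarrow> nat set set"
  assumes "n \<ge> 4"
    and "\<forall>i\<in>{1..n}. graph_on n (G i)"
    and "\<forall>i\<in>{1..n}. graph_rho n (G i) > real n - 2"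
  shows "rainbow_ham_cycle n G \<or>
         ((\<forall>i\<in>{1..n}. G i = G 1) \<and> graph_iso n (G 1) (K1_join_Kn2_K1 n))"
proof -
  have adm: "\<forall>c\<in>{1..n}. admissible n (G c)"
    using admissible_of_graph_rho assms by blast
  show ?thesis
  proof (cases "\<exists>c\<in>{1..n}. dense n (G c)")
    case True
    then show ?thesis using rainbow_of_dense assms(1) adm by blast
  next
    case False
    have "\<forall>c\<in>{1..n}. \<exists>u w. u \<in> {1..n} \<and> w \<in> {1..n} \<and> w \<noteq> u \<and> G c = pendant_clique n u w"
      using admissible_not_denseE[of n] False adm assms(1)
      by (metis le_trans one_le_numeral)
    then obtain u w where uw: "\<And>c. c \<in> {1..n} \<Longrightarrow> u c \<in> {1..n} \<and> w c \<in> {1..n} \<and> w c \<noteq> u c \<and>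
        G c = pendant_clique n (u c) (w c)" by metis
    have "1 \<in> {1..n}" using assms(1) by simp
    then have "graph_iso n (G 1) (K1_join_Kn2_K1 n)"
      using uw[of 1] pendant_clique_iso[of n "u 1" "w 1"] assms(1) by simp
    then show ?thesis using rainbow_or_equal_pendant_cliques[OF assms(1), of u w G] uw by blast
  qed
qed

end
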